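(* Let $M$ be a $\Delta$-matroid on $[n]$. The following are equivalent: 1. $M$ is a strong $\Delta$-matroid, i.e. it satisfies the hyperplane exchange property for $\Delta$-matroids: for all distinct $A,B\in M$ there exist (possibly equal) $a,b\in A\triangle B$ such that $A\triangle\{a,b\}\in M$ and $B\triangle\{a,b\}\in M$. 2. $M$ satisfies the weak Wenzel exchange property: for all $A,B\in M$ and all $a\in A\triangle B$ there exists $b\in A\triangle B$ (possibly $b=a$) such that $A\triangle\{a,b\}\in M$ and $B\triangle\{a,b\}\in M$. 3. $\overline{M}$ is an even $\Delta$-matroid on $[n]\cup\{*\}$. 4. $M$ has no peerless antipode in any $k$-cube for $k\ge 3$. 5. $M$ has no peerless antipode in any $3$-cube or $4$-cube, and has no isolated antipode in any $k$-cube for $k\ge 5$.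
   Context: A set system on a finite set $E$ is a (possibly empty) collection of subsets of $E$; $[n]=\{1,\dots,n\}$ and $\triangle$ is symmetric difference (when $a=b$, $\{a,b\}=\{a\}$). A $\Delta$-matroid on $E$ is a set system $M$ on $E$ such that for all $A,B\in M$ and $a\in A\triangle B$ there exists $b\in A\triangle B$ (possibly $b=a$) with $A\triangle\{a,b\}\in M$. A set system is even if all its members have cardinality of the same parity (all even or all odd); an even $\Delta$-matroid is a $\Delta$-matroid that is an even set system. For $I\subseteq[n]$ let $\overline I=I$ if $|I|$ is even and $\overline I=I\cup\{*\}$ if $|I|$ is odd, where $*\notin[n]$ is a new element. For a set system $M$ on $[n]$, $\overline M=\{\overline I: I\in M\}$, a set system on $[n]\cup\{*\}$. For $S\subseteq[n]$ let $\varepsilon_S\in\mathbb R^n$ be its indicator vector. For $I,J\subseteq[n]$ let $\square_{I,J}=\operatorname{conv}\{\varepsilon_S: I\cap J\subseteq S\subseteq I\cup J\}$; it is called a $k$-cube when $|I\triangle J|=k$. A pair $(S,T)$ (equivalently $(\varepsilon_S,\varepsilon_T)$) is an antipode of $\square_{I,J}$ if $S\cap T=I\cap J$ and $S\triangle T=I\triangle J$. For a set system $M$ on $[n]$ and $I,J\in M$: $(I,J)$ is a peerless antipode of $M$ in $\square_{I,J}$ if whenever $S,T\in M$ satisfy $S\cap T=I\cap J$ and $S\triangle T=I\triangle J$, then $\{S,T\}=\{I,J\}$; $(I,J)$ is an isolated antipode of $M$ in $\square_{I,J}$ if whenever $S\in M$ satisfies $I\cap J\subseteq S\subseteq I\cup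 J$, then $S=I$ or $S=J$. "$M$ has a peerless (isolated) antipode in a $k$-cube" means there are $I,J\in M$ with $|I\triangle J|=k$ such that $(I,J)$ is a peerless (isolated) antipode of $M$ in $\square_{I,J}$. *)

theory Defs
  imports Main
begin

definition set_system :: "'a set \<Rightarrow> 'a set set \<Rightarrow> bool" where
  "set_system E M \<longleftrightarrow> finite E \<and> M \<subseteq> Pow E"

definition delta_matroid :: "'a set \<Rightarrow> 'a set set \<Rightarrow> bool" where
  "delta_matroid E M \<longleftrightarrow> set_system E M \<and>
     (\<forall>A\<in>M. \<forall>B\<in>M. \<forall>a\<in>sym_diff A B. \<exists>b\<in>sym_diff A B. sym_diff A {a, b} \<in> M)"

definition even_set_system :: "'a set set \<Rightarrow> bool" where
  "even_set_system M \<longleftrightarrow> (\<forall>A\<in>M. even (card A)) \<or> (\<forall>A\<in>M. odd (card A))"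

definition even_delta_matroid :: "'a set \<Rightarrow> 'a set set \<Rightarrow> bool" where
  "even_delta_matroid E M \<longleftrightarrow> delta_matroid E M \<and> even_set_system M"

definition hyperplane_exchange :: "'a set set \<Rightarrow> bool" where
  "hyperplane_exchange M \<longleftrightarrow>
     (\<forall>A\<in>M. \<forall>B\<in>M. A \<noteq> B \<longrightarrow>
        (\<exists>a\<in>sym_diff A B. \<exists>b\<in>sym_diff A B. sym_diff A {a, b} \<in> M \<and> sym_diff B {a, b} \<in> M))"

definition strong_delta_matroid :: "'a set \<Rightarrow> 'a set set \<Rightarrow> bool" where
  "strong_delta_matroid E M \<longleftrightarrow> delta_matroid E M \<and> hyperplane_exchange M"

definition weak_Wenzel_exchange :: "'a set set \<Rightarrow> bool" where
  "weak_Wenzel_exchange M \<longleftrightarrow>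
     (\<forall>A\<in>M. \<forall>B\<in>M. \<forall>a\<in>sym_diff A B. \<exists>b\<in>sym_diff A B.
        sym_diff A {a, b} \<in> M \<and> sym_diff B {a, b} \<in> M)"

text \<open>The extra element \<open>*\<close> is represented by \<^const>\<open>None\<close>, and the original elements are embedded
  by \<^const>\<open>Some\<close>, so that \<open>*\<close> is new by construction.\<close>

definition ground_bar :: "'a set \<Rightarrow> 'a option set" where
  "ground_bar E = insert None (Some ` E)"

definition set_bar :: "'a set \<Rightarrow> 'a option set" where
  "set_bar I = (if even (card I) then Some ` I else insert None (Some ` I))"

definition system_bar :: "'a set set \<Rightarrow> 'a option set set" where
  "system_bar M = set_bar ` M"

text \<open>The cube \<open>\<box>\<^bsub>I,J\<^esub>\<close> is the convex hull of the indicator vectors of the sets \<open>S\<close> with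
  \<open>I \<inter> J \<subseteq> S \<subseteq> I \<union> J\<close>. Antipodes involve only its vertices, which are identified here with
  these sets.\<close>

definition cube :: "'a set \<Rightarrow> 'a set \<Rightarrow> 'a set set" where
  "cube I J = {S. I \<inter> J \<subseteq> S \<and> S \<subseteq> I \<union> J}"

definition antipode :: "'a set \<Rightarrow> 'a set \<Rightarrow> 'a set \<Rightarrow> 'a set \<Rightarrow> bool" where
  "antipode I J S T \<longleftrightarrow> S \<inter> T = I \<inter> J \<and> sym_diff S T = sym_diff I J"

definition peerless_antipode :: "'a set set \<Rightarrow> 'a set \<Rightarrow> 'a set \<Rightarrow> bool" where
  "peerless_antipode M I J \<longleftrightarrow> I \<in> M \<and> J \<in> M \<and>
     (\<forall>S\<in>M. \<forall>T\<in>M. antipode I J S T \<longrightarrow> {S, T} = {I, J})"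

definition isolated_antipode :: "'a set set \<Rightarrow> 'a set \<Rightarrow> 'a set \<Rightarrow> bool" where
  "isolated_antipode M I J \<longleftrightarrow> I \<in> M \<and> J \<in> M \<and> (\<forall>S\<in>M. S \<in> cube I J \<longrightarrow> S = I \<or> S = J)"

definition has_peerless_antipode :: "'a set set \<Rightarrow> nat \<Rightarrow> bool" where
  "has_peerless_antipode M k \<longleftrightarrow>
     (\<exists>I\<in>M. \<exists>J\<in>M. card (sym_diff I J) = k \<and> peerless_antipode M I J)"

definition has_isolated_antipode :: "'a set set \<Rightarrow> nat \<Rightarrow> bool" where
  "has_isolated_antipode M k \<longleftrightarrow>
     (\<exists>I\<in>M. \<exists>J\<in>M. card (sym_diff I J) = k \<and> isolated_antipode M I J)"

end

theory Submission
  imports Defs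
begin

text \<open>
  In an even \<open>\<Delta>\<close>-matroid the exchange axiom can be applied to both sets simultaneously (Wenzel); for
  the extension of \<open>M\<close> by the parity element this is stronger than the weak Wenzel property of \<open>M\<close>.
  Conversely, since \<open>M\<close> is already a \<open>\<Delta>\<close>-matroid, its extension can only fail to be one because some
  \<open>A, B \<in> M\<close> at odd distance admit no \<open>b\<close> in their symmetric difference for which \<open>A\<close> changed at
  \<open>b\<close> is in \<open>M\<close>. At distance three this is excluded by the absence of peerless antipodes in 3-cubes.
  Larger distances reduce to it: change \<open>A\<close> in a pair, then by induction in a third element, and apply
  the case of distance three to \<open>A\<close> and the result. Hence 3-cubes alone decide the matter.
\<close>

section \<open>Simultaneous exchange\<close>

text \<open>In an even \<open>\<Delta>\<close>-matroid \<open>b = a\<close> is excluded by parity. Unlike parity, this form of the axiom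
  makes sense on infinite sets and is visibly invariant under twisting.\<close>

definition distinct_exchange :: "'a set set \<Rightarrow> bool" where
  "distinct_exchange N \<longleftrightarrow>
     (\<forall>A\<in>N. \<forall>B\<in>N. \<forall>a\<in>sym_diff A B. \<exists>b\<in>sym_diff A B. b \<noteq> a \<and> sym_diff A {a, b} \<in> N)"

lemma distinct_exchangeE:
  assumes "distinct_exchange N" "A \<in> N" "B \<in> N" "a \<in> sym_diff A B"
  obtains b where "b \<in> sym_diff A B" "b \<noteq> a" "sym_diff A {a, b} \<in> N"
  using assms unfolding distinct_exchange_def by blast

text \<open>Translation by \<open>C\<close>, written as a preimage; since symmetric difference with
  \<open>C\<close> is an involution, this is also the image of \<open>N\<close> under it. It serves
  to move any chosen member to the empty set.\<close>

definition twist :: "'a set \<Rightarrow> 'a set set \<Rightarrow> 'a set set" where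
  "twist C N = {X. sym_diff C X \<in> N}"

lemma distinct_exchange_twist:
  assumes "distinct_exchange N"
  shows "distinct_exchange (twist C N)"
  unfolding distinct_exchange_def
proof (intro ballI)
  fix A B a
  assume AB: "A \<in> twist C N" "B \<in> twist C N" and a: "a \<in> sym_diff A B"
  have eq: "sym_diff (sym_diff C A) (sym_diff C B) = sym_diff A B"
    by blast
  have "sym_diff C A \<in> N" "sym_diff C B \<in> N" "a \<in> sym_diff (sym_diff C A) (sym_diff C B)"
    unfolding eq using AB a unfolding twist_def by (simp_all only: mem_Collect_eq)
  then obtain b where b: "b \<in> sym_diff (sym_diff C A) (sym_diff C B)" "b \<noteq> a"
    "sym_diff (sym_diff C A) {a, b} \<in> N"
    by (rule distinct_exchangeE[OF assms])
  have "sym_diff (sym_diff C A) {a, b} = sym_diff C (sym_diff A {a, b})"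
    by blast
  then have "sym_diff A {a, b} \<in> twist C N"
    using b(3) unfolding twist_def by (simp only: mem_Collect_eq)
  then show "\<exists>b\<in>sym_diff A B. b \<noteq> a \<and> sym_diff A {a, b} \<in> twist C N"
    using b(1,2) unfolding eq by blast
qed

text \<open>Induction on the size of \<open>B\<close>. If every \<open>b\<close> fails, a
  four-element member of \<open>N\<close> containing \<open>a\<close> is found none of whose
  elements can be removed together with one particular element \<open>w\<close> without leaving
  \<open>N\<close>.\<close>

lemma simultaneous_exchange_empty:
  assumes "distinct_exchange N" "finite B" "{} \<in> N" "B \<in> N" "a \<in> B"
  shows "\<exists>b\<in>B. b \<noteq> a \<and> {a, b} \<in> N \<and> B - {a, b} \<in> N"
  using assms
proof (induction "card B" arbitrary: B N rule: less_induct)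
  case less
  note ex = less.prems(1) and fin = less.prems(2) and mem = less.prems(3,4) and a = less.prems(5)
  \<comment> \<open>The exchange axiom between \<open>{}\<close> and a member \<open>F\<close>,
    first starting at \<open>{}\<close> and then at \<open>F\<close>: a pair inside \<open>F\<close>
    can be inserted, respectively deleted, with one element prescribed.\<close>
  have up: "\<exists>q\<in>F. q \<noteq> p \<and> {p, q} \<in> N" if "F \<in> N" "p \<in> F" for F p
    using distinct_exchangeE[OF ex mem(1), of F p] that by auto
  have down: "\<exists>q\<in>F. q \<noteq> p \<and> F - {p, q} \<in> N" if F: "F \<in> N" "p \<in> F" for F p
  proof -
    obtain q where q: "q \<in> F" "q \<noteq> p" "sym_diff F {p, q} \<in> N"
      using distinct_exchangeE[OF ex F(1) mem(1), of p] F(2) by auto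
    moreover have "sym_diff F {p, q} = F - {p, q}"
      using q F(2) by blast
    ultimately show ?thesis by auto
  qed
  show ?case
  proof (rule ccontr)
    assume "\<not> ?thesis"
    then have disj: "\<not> ({a, b} \<in> N \<and> B - {a, b} \<in> N)" if "b \<in> B" "b \<noteq> a" for b
      using that by blast
    \<comment> \<open>Twisting by \<open>{z, w}\<close> makes this pair the new empty set and turns
      \<open>B\<close> into the smaller \<open>B - {z, w}\<close>, which still contains
      \<open>a\<close>. The induction hypothesis there, twisted back, yields both
      memberships.\<close>
    have lift: "\<exists>b\<in>B. b \<notin> {a, z, w} \<and> {a, b, z, w} \<in> N \<and> B - {a, b} \<in> N"
      if zw: "{z, w} \<in> N" "z \<in> B" "w \<in> B" "z \<noteq> a" "w \<noteq> a" for z w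
    proof -
      have twB: "sym_diff {z, w} (B - {z, w}) = B"
        using zw by blast
      have "card (B - {z, w}) < card B"
        using fin zw by (intro psubset_card_mono) auto
      moreover have "{} \<in> twist {z, w} N" "B - {z, w} \<in> twist {z, w} N"
        using zw(1) mem(2) twB unfolding twist_def by simp_all
      ultimately obtain b where b: "b \<in> B - {z, w}" "b \<noteq> a"
        "{a, b} \<in> twist {z, w} N" "B - {z, w} - {a, b} \<in> twist {z, w} N"
        using less.hyps[of "B - {z, w}" "twist {z, w} N"] distinct_exchange_twist[OF ex] fin a zw(4,5)
        by blast
      have "sym_diff {z, w} {a, b} = {a, b, z, w}"
        using b(1) zw(4,5) by auto
      moreover have "sym_diff {z, w} (B - {z, w} - {a, b}) = B - {a, b}"
        using b(1) zw by blast
      ultimately show ?thesis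
        using b unfolding twist_def by auto
    qed
    \<comment> \<open>The \<open>b\<close> from \<open>lift\<close> has \<open>B - {a, b}\<close> in
      \<open>N\<close>, so \<open>{a, b}\<close> is not in \<open>N\<close>. Exchanging at
      \<open>a\<close> from \<open>{}\<close> towards \<open>{a, b, z, w}\<close> must therefore use
      \<open>z\<close> or \<open>w\<close>.\<close>
    have hit: "{a, z} \<in> N \<or> {a, w} \<in> N"
      if zw: "{z, w} \<in> N" "z \<in> B" "w \<in> B" "z \<noteq> a" "w \<noteq> a" for z w
    proof -
      obtain b where b: "b \<in> B" "b \<notin> {a, z, w}" "{a, b, z, w} \<in> N" "B - {a, b} \<in> N"
        using lift[OF zw] by blast
      have "\<exists>q\<in>{a, b, z, w}. q \<noteq> a \<and> {a, q} \<in> N"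
        using up[OF b(3), of a] by simp
      moreover have "{a, b} \<notin> N"
        using disj[of b] b by blast
      ultimately show ?thesis by blast
    qed
    \<comment> \<open>Choosing \<open>y\<close> and \<open>x\<close> with \<open>B - {a, y}\<close>
      and \<open>B - {a, x}\<close> in \<open>N\<close> keeps \<open>{a, y}\<close> and
      \<open>{a, x}\<close> out of \<open>N\<close>; then \<open>hit\<close> excludes
      \<open>{x, y}\<close> as well.\<close>
    obtain y where y: "y \<in> B" "y \<noteq> a" "B - {a, y} \<in> N"
      using down[OF mem(2) a] by blast
    have ay: "{a, y} \<notin> N"
      using disj[OF y(1,2)] y(3) by blast
    obtain w where w: "w \<in> B" "w \<noteq> y" "{y, w} \<in> N"
      using up[OF mem(2) y(1)] by blast
    have wa: "w \<noteq> a"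
      using w(3) ay by (metis insert_commute)
    obtain x where x: "x \<in> B" "x \<notin> {a, y, w}" "{a, x, y, w} \<in> N" "B - {a, x} \<in> N"
      using lift[OF w(3) y(1) w(1) y(2) wa] by blast
    have ax: "{a, x} \<notin> N"
      using disj[of x] x by blast
    have xy: "{x, y} \<notin> N"
      using hit[of x y] x y ax ay by blast
    \<comment> \<open>Deleting \<open>w\<close> with a partner from the four-element member leaves
      one of the three pairs just excluded.\<close>
    obtain v where v: "v \<in> {a, x, y, w}" "v \<noteq> w" "{a, x, y, w} - {w, v} \<in> N"
      using down[OF x(3), of w] by blast
    have "{a, x, y, w} - {w, a} = {x, y}" "{a, x, y, w} - {w, x} = {a, y}"
      "{a, x, y, w} - {w, y} = {a, x}"
      using x(2) y(2) w(2) wa by auto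
    moreover have "v = a \<or> v = x \<or> v = y"
      using v(1,2) by blast
    ultimately show False
      using v(3) ax ay xy by metis
  qed
qed

text \<open>Twisting by \<open>A\<close> sends \<open>A\<close> to the empty set and
  \<open>B\<close> to their symmetric difference.\<close>

lemma simultaneous_exchange:
  assumes "distinct_exchange N" "finite (sym_diff A B)" "A \<in> N" "B \<in> N" "a \<in> sym_diff A B"
  obtains b where "b \<in> sym_diff A B" "b \<noteq> a" "sym_diff A {a, b} \<in> N" "sym_diff B {a, b} \<in> N"
proof -
  have "sym_diff A (sym_diff A B) = B"
    by blast
  then have "{} \<in> twist A N" "sym_diff A B \<in> twist A N"
    using assms(3,4) unfolding twist_def by auto
  from simultaneous_exchange_empty[OF distinct_exchange_twist[OF assms(1)] assms(2) this assms(5)]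
  obtain b where b: "b \<in> sym_diff A B" "b \<noteq> a" "{a, b} \<in> twist A N"
    "sym_diff A B - {a, b} \<in> twist A N"
    by (elim bexE conjE)
  have "sym_diff A (sym_diff A B - {a, b}) = sym_diff B {a, b}"
    using b(1) assms(5) by auto
  with b that show thesis
    unfolding twist_def by auto
qed

section \<open>The even extension\<close>

lemma even_card_sym_diff:
  assumes "finite A" "finite B"
  shows "even (card (sym_diff A B)) \<longleftrightarrow> (even (card A) \<longleftrightarrow> even (card B))"
proof -
  have "card A = card (A - B) + card (A \<inter> B)"
    using assms by (metis add.commute card_Int_Diff)
  moreover have "card B = card (B - A) + card (A \<inter> B)"
    using assms by (metis Int_commute add.commute card_Int_Diff)
  moreover have "card (sym_diff A B) = card (A - B) + card (B - A)"
    using assms by (intro card_Un_disjoint) auto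
  ultimately show ?thesis
    by simp blast
qed

lemma Some_in_set_bar [simp]: "Some a \<in> set_bar I \<longleftrightarrow> a \<in> I"
  by (auto simp: set_bar_def)

lemma None_in_set_bar [simp]: "None \<in> set_bar I \<longleftrightarrow> odd (card I)"
  by (auto simp: set_bar_def)

lemma set_bar_in_system_bar [simp]: "set_bar I \<in> system_bar M \<longleftrightarrow> I \<in> M"
proof -
  have "inj set_bar"
    by (rule injI) (metis Some_in_set_bar set_eqI)
  then show ?thesis
    unfolding system_bar_def by (rule inj_image_mem_iff)
qed

lemma even_card_set_bar:
  assumes "finite I"
  shows "even (card (set_bar I))"
  using assms by (auto simp: set_bar_def card_image)

text \<open>The coordinate \<open>None\<close> records the parity of the cardinality, which is
  additive modulo 2 under symmetric difference.\<close>

lemma sym_diff_set_bar: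
  assumes "finite A" "finite B"
  shows "sym_diff (set_bar A) (set_bar B) = set_bar (sym_diff A B)"
proof (rule set_eqI)
  fix x
  show "x \<in> sym_diff (set_bar A) (set_bar B) \<longleftrightarrow> x \<in> set_bar (sym_diff A B)"
    using even_card_sym_diff[OF assms] by (cases x) auto
qed

lemma sym_diff_set_bar_singleton:
  assumes "finite A"
  shows "sym_diff (set_bar A) {Some a, None} = set_bar (sym_diff A {a})"
proof -
  have "set_bar {a} = {Some a, None}"
    by (auto simp: set_bar_def)
  moreover have "finite {a}"
    by simp
  ultimately show ?thesis
    using sym_diff_set_bar[OF assms] by metis
qed

lemma sym_diff_set_bar_pair:
  assumes "finite A" "a \<noteq> b"
  shows "sym_diff (set_bar A) {Some a, Some b} = set_bar (sym_diff A {a, b})"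
proof -
  have "set_bar {a, b} = {Some a, Some b}"
    using assms(2) by (simp add: set_bar_def)
  moreover have "finite {a, b}"
    by simp
  ultimately show ?thesis
    using sym_diff_set_bar[OF assms(1)] by metis
qed

section \<open>From the even extension to the weak Wenzel property\<close>

lemma delta_matroid_finite:
  assumes "delta_matroid E M" "A \<in> M"
  shows "finite A"
  using assms unfolding delta_matroid_def set_system_def by (auto intro: finite_subset)

lemma delta_matroidE:
  assumes "delta_matroid E M" "A \<in> M" "B \<in> M" "a \<in> sym_diff A B"
  obtains b where "b \<in> sym_diff A B" "sym_diff A {a, b} \<in> M"
  using assms unfolding delta_matroid_def by blast

text \<open>The choice \<open>b = a\<close> would change the cardinality by one and so break the
  common parity.\<close>

lemma even_delta_matroid_distinct_exchange:
  assumes "even_delta_matroid E N"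
  shows "distinct_exchange N"
  unfolding distinct_exchange_def
proof (intro ballI)
  fix A B a
  assume AB: "A \<in> N" "B \<in> N" and a: "a \<in> sym_diff A B"
  have dm: "delta_matroid E N" and ev: "even_set_system N"
    using assms by (auto simp: even_delta_matroid_def)
  obtain b where b: "b \<in> sym_diff A B" "sym_diff A {a, b} \<in> N"
    using delta_matroidE[OF dm AB a] .
  have "sym_diff A {a} \<notin> N"
    using even_card_sym_diff[OF delta_matroid_finite[OF dm AB(1)], of "{a}"] ev AB(1)
    unfolding even_set_system_def by auto
  with b have "b \<noteq> a"
    by auto
  with b show "\<exists>b\<in>sym_diff A B. b \<noteq> a \<and> sym_diff A {a, b} \<in> N"
    by blast
qed

lemma weak_Wenzel_exchange_if_even_delta_matroid:
  assumes dm: "delta_matroid E M" and ext: "even_delta_matroid F (system_bar M)"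
  shows "weak_Wenzel_exchange M"
  unfolding weak_Wenzel_exchange_def
proof (intro ballI)
  fix A B a
  assume AB: "A \<in> M" "B \<in> M" and a: "a \<in> sym_diff A B"
  have fin: "finite A" "finite B"
    using AB delta_matroid_finite[OF dm] by auto
  have "finite (sym_diff (set_bar A) (set_bar B))"
    using fin by (simp add: set_bar_def)
  moreover have "set_bar A \<in> system_bar M" "set_bar B \<in> system_bar M"
    using AB by simp_all
  moreover have "Some a \<in> sym_diff (set_bar A) (set_bar B)"
    using a by simp
  ultimately obtain c where c: "c \<in> sym_diff (set_bar A) (set_bar B)" "c \<noteq> Some a"
    "sym_diff (set_bar A) {Some a, c} \<in> system_bar M"
    "sym_diff (set_bar B) {Some a, c} \<in> system_bar M"
    by (rule simultaneous_exchange[OF even_delta_matroid_distinct_exchange[OF ext]])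
  show "\<exists>b\<in>sym_diff A B. sym_diff A {a, b} \<in> M \<and> sym_diff B {a, b} \<in> M"
  proof (cases c)
    \<comment> \<open>The partner \<open>None\<close> means that only \<open>a\<close> changes in
      \<open>M\<close>, which is the choice \<open>b = a\<close>.\<close>
    case None
    have "sym_diff A {a} \<in> M" "sym_diff B {a} \<in> M"
      using c(3,4) unfolding None sym_diff_set_bar_singleton[OF fin(1)]
        sym_diff_set_bar_singleton[OF fin(2)] set_bar_in_system_bar .
    then show ?thesis
      using a by (intro bexI[of _ a]) (simp_all only: insert_absorb2)
  next
    case (Some b)
    with c(2) have "a \<noteq> b"
      by simp
    have "sym_diff A {a, b} \<in> M" "sym_diff B {a, b} \<in> M"
      using c(3,4) unfolding Some sym_diff_set_bar_pair[OF fin(1) \<open>a \<noteq> b\<close>]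
        sym_diff_set_bar_pair[OF fin(2) \<open>a \<noteq> b\<close>] set_bar_in_system_bar .
    moreover have "b \<in> sym_diff A B"
      using c(1) Some by simp
    ultimately show ?thesis by blast
  qed
qed

section \<open>Peerless antipodes\<close>

lemma hyperplane_exchangeE:
  assumes "hyperplane_exchange M" "A \<in> M" "B \<in> M" "A \<noteq> B"
  obtains a b where "a \<in> sym_diff A B" "b \<in> sym_diff A B"
    "sym_diff A {a, b} \<in> M" "sym_diff B {a, b} \<in> M"
  using assms unfolding hyperplane_exchange_def by blast

lemma hyperplane_exchange_if_weak_Wenzel:
  assumes "weak_Wenzel_exchange M"
  shows "hyperplane_exchange M"
  unfolding hyperplane_exchange_def
proof (intro ballI impI)
  fix A B
  assume AB: "A \<in> M" "B \<in> M" "A \<noteq> B"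
  then obtain a where "a \<in> sym_diff A B"
    by blast
  moreover from this
  have "\<exists>b\<in>sym_diff A B. sym_diff A {a, b} \<in> M \<and> sym_diff B {a, b} \<in> M"
    using assms AB(1,2) unfolding weak_Wenzel_exchange_def by simp
  ultimately show "\<exists>a\<in>sym_diff A B. \<exists>b\<in>sym_diff A B. sym_diff A {a, b} \<in> M \<and> sym_diff B {a, b} \<in> M"
    by (rule bexI[rotated])
qed

lemma peerless_antipodeD:
  assumes "peerless_antipode M I J" "S \<in> M" "T \<in> M" "antipode I J S T"
  shows "{S, T} = {I, J}"
  using assms by (simp add: peerless_antipode_def)

text \<open>Changing both ends of an antipode in the same \<open>{a, b}\<close> gives an antipode of
  the same cube. If it is no new one, then \<open>I\<close> and \<open>J\<close> differ in at most
  two elements.\<close>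

lemma no_peerless_antipode_if_hyperplane_exchange:
  assumes "hyperplane_exchange M" "k \<ge> 3"
  shows "\<not> has_peerless_antipode M k"
proof
  assume "has_peerless_antipode M k"
  then obtain I J where IJ: "I \<in> M" "J \<in> M" "card (sym_diff I J) = k"
    and peer: "peerless_antipode M I J"
    unfolding has_peerless_antipode_def by blast
  have "I \<noteq> J"
    using IJ(3) assms(2) by auto
  then obtain a b where ab: "a \<in> sym_diff I J" "b \<in> sym_diff I J"
    "sym_diff I {a, b} \<in> M" "sym_diff J {a, b} \<in> M"
    by (rule hyperplane_exchangeE[OF assms(1) IJ(1,2)])
  have "antipode I J (sym_diff I {a, b}) (sym_diff J {a, b})"
    unfolding antipode_def using ab(1,2) by blast
  then have "{sym_diff I {a, b}, sym_diff J {a, b}} = {I, J}"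
    by (rule peerless_antipodeD[OF peer ab(3,4)])
  moreover have "sym_diff I {a, b} \<noteq> I"
    by blast
  ultimately have "sym_diff I {a, b} = J"
    by (metis doubleton_eq_iff)
  then have "sym_diff I J = {a, b}"
    by blast
  moreover have "card {a, b} \<le> 2"
    by (simp add: card_insert_if)
  ultimately show False
    using IJ(3) assms(2) by simp
qed

text \<open>Both sets of an antipode are vertices of the cube, so isolation leaves only
  \<open>I\<close> and \<open>J\<close> for them; they are distinct because
  \<open>k > 0\<close>.\<close>

lemma has_peerless_antipode_if_isolated:
  assumes "has_isolated_antipode M k" "k > 0"
  shows "has_peerless_antipode M k"
proof -
  obtain I J where IJ: "I \<in> M" "J \<in> M" "card (sym_diff I J) = k"
    and iso: "\<And>S. S \<in> M \<Longrightarrow> S \<in> cube I J \<Longrightarrow> S = I \<or> S = J"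
    using assms(1) unfolding has_isolated_antipode_def isolated_antipode_def by blast
  have "{S, T} = {I, J}" if ST: "S \<in> M" "T \<in> M" "antipode I J S T" for S T
  proof -
    have "S \<in> cube I J" "T \<in> cube I J"
      using ST(3) unfolding cube_def antipode_def by blast+
    then have "S = I \<or> S = J" "T = I \<or> T = J"
      using iso ST by blast+
    moreover have "S \<noteq> T"
      using ST(3) IJ(3) assms(2) unfolding antipode_def by auto
    ultimately show ?thesis by blast
  qed
  then show ?thesis
    using IJ unfolding has_peerless_antipode_def peerless_antipode_def by blast
qed

section \<open>From 3-cubes to the even extension\<close>

text \<open>A second antipode \<open>S\<close>, \<open>T\<close> splits the three differing elements
  into the changes from \<open>A\<close> to \<open>S\<close> and from \<open>A\<close> to
  \<open>T\<close>. Neither part is empty, so one is a singleton.\<close>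

lemma odd_exchange_card_3:
  assumes "\<not> has_peerless_antipode M 3" "A \<in> M" "B \<in> M" "card (sym_diff A B) = 3"
  shows "\<exists>b\<in>sym_diff A B. sym_diff A {b} \<in> M"
proof -
  have "\<not> peerless_antipode M A B"
    using assms unfolding has_peerless_antipode_def by metis
  then obtain S T where ST: "S \<in> M" "T \<in> M" "antipode A B S T" "{S, T} \<noteq> {A, B}"
    using assms(2,3) unfolding peerless_antipode_def by metis
  let ?D = "sym_diff A B" and ?X = "sym_diff A S" and ?Y = "sym_diff A T"
  have part: "?X \<union> ?Y = ?D" "?X \<inter> ?Y = {}"
    using ST(3) unfolding antipode_def by blast+
  have fin: "finite ?D"
    using assms(4) by (metis card.infinite zero_neq_numeral)
  then have finXY: "finite ?X" "finite ?Y"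
    using part(1) by (metis finite_Un)+
  have "card ?X + card ?Y = 3"
    using card_Un_disjoint[OF finXY part(2)] unfolding part(1) assms(4) by (rule sym)
  moreover have "card ?X \<noteq> 0"
  proof
    assume "card ?X = 0"
    then have "?X = {}"
      using finXY(1) by (simp only: card_0_eq)
    then have "S = A" "?Y = ?D"
      using part by blast+
    then have "T = B" by blast
    with \<open>S = A\<close> ST(4) show False by blast
  qed
  moreover have "card ?Y \<noteq> 0"
  proof
    assume "card ?Y = 0"
    then have "?Y = {}"
      using finXY(2) by (simp only: card_0_eq)
    then have "T = A" "?X = ?D"
      using part by blast+
    then have "S = B" by blast
    with \<open>T = A\<close> ST(4) show False by blast
  qed
  ultimately have "card ?X = 1 \<or> card ?Y = 1"
    by linarith
  then obtain R x where R: "R \<in> M" "sym_diff A R = {x}" "sym_diff A R \<subseteq> ?D"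
    using ST(1,2) part(1) card_1_singletonE by (metis Un_upper1 Un_upper2)
  then have "sym_diff A {x} = R"
    by blast
  with R show ?thesis by blast
qed

text \<open>This is exchange at \<open>None\<close> in the extension: \<open>None\<close> separates
  two members exactly at odd distance, and its partner \<open>Some b\<close> amounts to changing
  \<open>A\<close> in \<open>b\<close> alone.\<close>

lemma odd_exchange:
  assumes dm: "delta_matroid E M" and peer: "\<not> has_peerless_antipode M 3"
    and "A \<in> M" "B \<in> M" "odd (card (sym_diff A B))"
  shows "\<exists>b\<in>sym_diff A B. sym_diff A {b} \<in> M"
  using assms(3-)
proof (induction "card (sym_diff A B)" arbitrary: A B rule: less_induct)
  case less
  let ?D = "sym_diff A B"
  consider "card ?D = 1" | "card ?D = 3" | "card ?D > 3"
  proof -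
    have "n = 1 \<or> n = 3 \<or> n > 3" if "odd n" for n :: nat
      using that by presburger
    then show thesis
      using less.prems(3) that by blast
  qed
  then show ?case
  proof cases
    case 1
    then obtain x where "?D = {x}"
      by (rule card_1_singletonE)
    then have "sym_diff A {x} = B"
      by blast
    with \<open>?D = {x}\<close> less.prems show ?thesis by blast
  next
    case 2
    then show ?thesis
      using odd_exchange_card_3[OF peer less.prems(1,2)] by blast
  next
    case 3
    have fin: "finite ?D"
      using less.prems delta_matroid_finite[OF dm] by simp
    obtain a where a: "a \<in> ?D"
      using 3 by (metis card.empty ex_in_conv not_less_zero)
    obtain b where b: "b \<in> ?D" "sym_diff A {a, b} \<in> M"
      using delta_matroidE[OF dm less.prems(1,2) a] .
    show ?thesis
    proof (cases "b = a")
      case True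
      with a b show ?thesis by auto
    next
      case False
      \<comment> \<open>\<open>?C\<close> is two steps closer to \<open>B\<close> and still at odd
        distance, so the induction hypothesis applies. It gives a member \<open>?F\<close> that
        differs from \<open>A\<close> in exactly \<open>a\<close>, \<open>b\<close>,
        \<open>c\<close>, all within the original difference.\<close>
      let ?C = "sym_diff A {a, b}"
      have CB: "sym_diff ?C B = ?D - {a, b}"
        using a b(1) by blast
      have cardCB: "card (sym_diff ?C B) = card ?D - 2"
        unfolding CB using card_Diff_subset[of "{a, b}" ?D] a b(1) False by simp
      then have "odd (card (sym_diff ?C B))" "card (sym_diff ?C B) < card ?D"
        using less.prems(3) 3 by auto
      then obtain c where c: "c \<in> sym_diff ?C B" "sym_diff ?C {c} \<in> M"
        using less.hyps[OF _ b(2) less.prems(2)] by blast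
      have cD: "c \<in> ?D" "c \<noteq> a" "c \<noteq> b"
        using c(1) CB by blast+
      let ?F = "sym_diff ?C {c}"
      have AF: "sym_diff A ?F = {a, b, c}"
        using cD by blast
      then have "card (sym_diff A ?F) = 3"
        using False cD by simp
      then obtain d where "d \<in> sym_diff A ?F" "sym_diff A {d} \<in> M"
        using odd_exchange_card_3[OF peer less.prems(1) c(2)] by blast
      moreover have "{a, b, c} \<subseteq> ?D"
        using a b(1) cD(1) by blast
      ultimately show ?thesis
        unfolding AF by blast
    qed
  qed
qed

text \<open>If the axiom returns \<open>b = a\<close>, then \<open>A\<close> changed in
  \<open>a\<close> is a member at odd distance from \<open>B\<close>, and
  \<open>odd_exchange\<close> there supplies a second element, different from
  \<open>a\<close>.\<close>

lemma even_exchange: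
  assumes dm: "delta_matroid E M" and peer: "\<not> has_peerless_antipode M 3"
    and AB: "A \<in> M" "B \<in> M" and ev: "even (card (sym_diff A B))" and a: "a \<in> sym_diff A B"
  obtains b where "b \<in> sym_diff A B" "b \<noteq> a" "sym_diff A {a, b} \<in> M"
proof -
  obtain b where b: "b \<in> sym_diff A B" "sym_diff A {a, b} \<in> M"
    using delta_matroidE[OF dm AB a] .
  show thesis
  proof (cases "b = a")
    case False
    with b that show thesis by blast
  next
    case True
    let ?C = "sym_diff A {a}"
    have C: "?C \<in> M"
      using b(2) True by simp
    have CB: "sym_diff ?C B = sym_diff A B - {a}"
      using a by blast
    have "odd (card (sym_diff ?C B))"
      using even_card_sym_diff[OF delta_matroid_finite[OF dm AB(1)], of B]
        even_card_sym_diff[OF delta_matroid_finite[OF dm AB(1)], of "{a}"]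
        even_card_sym_diff[OF delta_matroid_finite[OF dm C], of B]
        delta_matroid_finite[OF dm AB(2)] ev by simp
    then obtain x where x: "x \<in> sym_diff ?C B" "sym_diff ?C {x} \<in> M"
      using odd_exchange[OF dm peer C AB(2)] by blast
    have xD: "x \<in> sym_diff A B" "x \<noteq> a"
      using x(1) CB by blast+
    have "sym_diff ?C {x} = sym_diff A {a, x}"
      using xD(2) by blast
    with x(2) that[OF xD] show thesis by simp
  qed
qed

lemma even_delta_matroid_system_bar:
  assumes dm: "delta_matroid E M" and peer: "\<not> has_peerless_antipode M 3"
  shows "even_delta_matroid (ground_bar E) (system_bar M)"
  unfolding even_delta_matroid_def delta_matroid_def
proof (intro conjI ballI)
  show "set_system (ground_bar E) (system_bar M)"
  proof -
    have "finite E" "M \<subseteq> Pow E"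
      using dm unfolding delta_matroid_def set_system_def by blast+
    moreover have "set_bar I \<subseteq> ground_bar E" if "I \<subseteq> E" for I
      using that by (auto simp: set_bar_def ground_bar_def)
    moreover have "finite (ground_bar E)" if "finite E"
      using that by (simp add: ground_bar_def)
    ultimately show ?thesis
      unfolding set_system_def system_bar_def by blast
  qed
  show "even_set_system (system_bar M)"
    unfolding even_set_system_def system_bar_def
    using even_card_set_bar delta_matroid_finite[OF dm] by blast
  fix A' B' a'
  assume "A' \<in> system_bar M" "B' \<in> system_bar M" and a': "a' \<in> sym_diff A' B'"
  then obtain A B where A'B': "A' = set_bar A" "B' = set_bar B" and AB: "A \<in> M" "B \<in> M"
    unfolding system_bar_def by blast
  have fin: "finite A" "finite B"
    using AB delta_matroid_finite[OF dm] by auto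
  have D: "sym_diff A' B' = set_bar (sym_diff A B)"
    unfolding A'B' using sym_diff_set_bar[OF fin] .
  have single: "sym_diff A' {Some b, None} \<in> system_bar M" if "sym_diff A {b} \<in> M" for b
    unfolding A'B' sym_diff_set_bar_singleton[OF fin(1)] using that by simp
  have pair: "sym_diff A' {Some a, Some b} \<in> system_bar M"
    if "a \<noteq> b" "sym_diff A {a, b} \<in> M" for a b
    unfolding A'B' sym_diff_set_bar_pair[OF fin(1) that(1)] using that(2) by simp
  show "\<exists>b\<in>sym_diff A' B'. sym_diff A' {a', b} \<in> system_bar M"
  proof (cases a')
    case None
    then have "odd (card (sym_diff A B))"
      using a' unfolding D by simp
    then obtain b where b: "b \<in> sym_diff A B" "sym_diff A {b} \<in> M"
      using odd_exchange[OF dm peer AB] by blast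
    then have "Some b \<in> sym_diff A' B'" "sym_diff A' {None, Some b} \<in> system_bar M"
      using single[OF b(2)] unfolding D by (simp_all only: Some_in_set_bar insert_commute[of None])
    with None show ?thesis by blast
  next
    case (Some a)
    then have a: "a \<in> sym_diff A B"
      using a' unfolding D by simp
    show ?thesis
    \<comment> \<open>The partner \<open>None\<close> is available only at odd distance. Otherwise a
      partner \<open>Some b\<close> with \<open>b\<close> different from \<open>a\<close> is needed:
      at even distance \<open>even_exchange\<close> gives it, and at odd distance the axiom cannot
      return \<open>a\<close>, since \<open>A\<close> changed in \<open>a\<close> is not in
      \<open>M\<close>.\<close>
    proof (cases "sym_diff A {a} \<in> M \<and> odd (card (sym_diff A B))")
      case True
      then have "None \<in> sym_diff A' B'" "sym_diff A' {Some a, None} \<in> system_bar M"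
        using single unfolding D by simp_all
      with Some show ?thesis by blast
    next
      case False
      obtain b where b: "b \<in> sym_diff A B" "b \<noteq> a" "sym_diff A {a, b} \<in> M"
      proof (cases "even (card (sym_diff A B))")
        case True
        then show thesis
          using even_exchange[OF dm peer AB _ a] that by blast
      next
        case odd: False
        obtain b where b: "b \<in> sym_diff A B" "sym_diff A {a, b} \<in> M"
          using delta_matroidE[OF dm AB a] .
        with odd False have "b \<noteq> a"
          by auto
        with b that show thesis by blast
      qed
      then have "Some b \<in> sym_diff A' B'" "sym_diff A' {Some a, Some b} \<in> system_bar M"
        using pair[of a b] unfolding D by simp_all
      with Some show ?thesis by blast
    qed
  qed
qed

theorem theoremA:
  fixes n :: nat and M :: "nat set set"
  assumes "delta_matroid {1..n} M"
  shows "(strong_delta_matroid {1..n} M \<longleftrightarrow> weak_Wenzel_exchange M)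
    \<and> (weak_Wenzel_exchange M \<longleftrightarrow> even_delta_matroid (ground_bar {1..n}) (system_bar M))
    \<and> (even_delta_matroid (ground_bar {1..n}) (system_bar M)
         \<longleftrightarrow> (\<forall>k\<ge>3. \<not> has_peerless_antipode M k))
    \<and> ((\<forall>k\<ge>3. \<not> has_peerless_antipode M k)
         \<longleftrightarrow> \<not> has_peerless_antipode M 3 \<and> \<not> has_peerless_antipode M 4
             \<and> (\<forall>k\<ge>5. \<not> has_isolated_antipode M k))"
proof -
  let ?strong = "strong_delta_matroid {1..n} M" and ?Wenzel = "weak_Wenzel_exchange M"
    and ?even = "even_delta_matroid (ground_bar {1..n}) (system_bar M)"
    and ?peerless = "\<forall>k\<ge>3. \<not> has_peerless_antipode M k"
    and ?isolated = "\<not> has_peerless_antipode M 3 \<and> \<not> has_peerless_antipode M 4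
             \<and> (\<forall>k\<ge>5. \<not> has_isolated_antipode M k)"
  \<comment> \<open>The five properties are linked in a cycle: \<open>?Wenzel\<close>,
    \<open>?strong\<close>, \<open>?peerless\<close>, \<open>?isolated\<close>, \<open>?even\<close>
    and back to \<open>?Wenzel\<close>.\<close>
  have "?Wenzel \<Longrightarrow> hyperplane_exchange M"
    by (rule hyperplane_exchange_if_weak_Wenzel)
  then have "?Wenzel \<Longrightarrow> ?strong"
    using assms unfolding strong_delta_matroid_def by blast
  moreover have "?strong \<Longrightarrow> ?peerless"
    using no_peerless_antipode_if_hyperplane_exchange unfolding strong_delta_matroid_def by blast
  moreover have "?isolated" if ?peerless
  proof (intro conjI allI impI)
    fix k :: nat
    assume "5 \<le> k"
    then have "\<not> has_peerless_antipode M k" "k > 0"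
      using that by simp_all
    then show "\<not> has_isolated_antipode M k"
      using has_peerless_antipode_if_isolated by blast
  qed (use that in simp_all)
  moreover have "?isolated \<Longrightarrow> ?even"
    using even_delta_matroid_system_bar[OF assms] by blast
  moreover have "?even \<Longrightarrow> ?Wenzel"
    using weak_Wenzel_exchange_if_even_delta_matroid[OF assms] .
  ultimately show ?thesis
    by argo
qed

end
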